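(* Fix $0<\delta<1$. Assume the following hypothesis: for all integers $m,n\geq 1$, all real $\eta$ with $0<\eta<1$, and all integers $0\leq r_m<m$, $0\leq r_n<n$, $$\mathbb{P}\left([x^\eta]\equiv r_m \bmod m \,\middle|\, x\equiv r_n \bmod n\right)=\frac1m.$$ Then $$\sum_{m,n=1}^\infty\ \lim_{X\rightarrow \infty}\frac{1}{X}\sum_{x=1}^X \frac{\mu(m)\mu(n)}{mn}\left(\left\{\frac{x}{n}\right\}\left\{\frac{x}{m}\right\}-\left\{\frac{x+[x^\delta]}{n}\right\}\left\{\frac{x}{m}\right\}-\left\{\frac{x}{n}\right\}\left\{\frac{x+[x^\delta]}{m}\right\}+\left\{\frac{x+[x^\delta]}{n}\right\}\left\{\frac{x+[x^\delta]}{m}\right\}\right)=\frac{1}{6\zeta(2)}-\frac{1}{6\zeta(2)^2},$$ where for each pair $(m,n)$ the limit over positive integers $X$ is taken first, and the sum over all pairs of positive integers $(m,n)$ is taken afterwards.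
   Context: $\mu$ is the Möbius function on positive integers, $\zeta$ is the Riemann zeta function, $[y]$ is the integer part (floor) of a real number $y$, and $\{y\}=y-[y]$ is its fractional part. The conditional probability $\mathbb{P}(\cdot\mid\cdot)$ is the limiting frequency over positive integers $x$: $\mathbb{P}([x^\eta]\equiv r_m \bmod m \mid x\equiv r_n\bmod n)=\lim_{X\to\infty}\frac{\#\{1\le x\le X:\ x\equiv r_n \bmod n,\ [x^\eta]\equiv r_m\bmod m\}}{\#\{1\le x\le X:\ x\equiv r_n\bmod n\}}$. *)

theory Defs
  imports
    "HOL-Analysis.Analysis"
    "HOL-Computational_Algebra.Squarefree"
    "HOL-Number_Theory.Cong"
begin

definition moebius :: "nat \<Rightarrow> int" where
  "moebius n = (if squarefree n then (-1) ^ card (prime_factors n) else 0)"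

text \<open>
  The Riemann zeta function by its Dirichlet series; the definition is meaningful only for
  \<open>s > 1\<close>, where the series converges.
\<close>
definition riemann_zeta :: "real \<Rightarrow> real" where
  "riemann_zeta s = (\<Sum>k. 1 / real (Suc k) powr s)"

text \<open>
  The limiting frequency is stated as a limit rather than as the value of a total function, so
  that \<open>cond_prob P Q p\<close> includes the existence of the limit. For the finitely many \<open>X\<close> with
  denominator \<open>0\<close> the quotient is \<open>0\<close>; this does not affect the limit.
\<close>
definition cond_prob :: "(nat \<Rightarrow> bool) \<Rightarrow> (nat \<Rightarrow> bool) \<Rightarrow> real \<Rightarrow> bool" where
  "cond_prob P Q p \<longleftrightarrow>
     (\<lambda>X. real (card {x \<in> {1..X}. Q x \<and> P x}) / real (card {x \<in> {1..X}. Q x}))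
       \<longlonglongrightarrow> p"

definition summand :: "real \<Rightarrow> nat \<Rightarrow> nat \<Rightarrow> nat \<Rightarrow> real" where
  "summand \<delta> m n x =
     (let y = real x + of_int \<lfloor>real x powr \<delta>\<rfloor> in
      of_int (moebius m) * of_int (moebius n) / (real m * real n) *
        (frac (real x / real n) * frac (real x / real m)
         - frac (y / real n) * frac (real x / real m)
         - frac (real x / real n) * frac (y / real m)
         + frac (y / real n) * frac (y / real m)))"

definition average :: "(nat \<Rightarrow> real) \<Rightarrow> nat \<Rightarrow> real" where
  "average f X = 1 / real X * (\<Sum>x = 1..X. f x)"

end

theory Submission imports Defs begin

text \<open>
  By the hypothesis, \<open>x\<close> and \<open>y = x + [x\<^sup>\<delta>]\<close> are asymptotically independent and uniform modulo
  \<open>lcm m n\<close>. The bracket factors as \<open>({x/n} - {y/n}) ({x/m} - {y/m})\<close>, so its mean is twice the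
  covariance of \<open>{x/n}\<close> and \<open>{x/m}\<close>, which is \<open>(gcd(m,n)\<^sup>2 - 1) / (12 m n)\<close>. As \<open>gcd(m,n) / (m n)\<close>
  equals \<open>1 / lcm(m,n)\<close>, it remains to see that the sum of \<open>\<mu>(m) \<mu>(n) / lcm(m,n)\<^sup>2\<close> is
  \<open>1 / \<zeta>(2)\<close> and that of \<open>\<mu>(m) \<mu>(n) / (m n)\<^sup>2\<close> is \<open>1 / \<zeta>(2)\<^sup>2\<close>.
\<close>

section \<open>The Moebius function and its divisor sum\<close>

text \<open>If \<open>d\<close> is squarefree, \<open>p\<close> is one further prime factor and
  flips the sign; otherwise both sides vanish. The value \<open>d = 0\<close> is excluded because
  \<open>p\<close> would divide it.\<close>

lemma moebius_prime_mult:
  assumes "prime p" "\<not> p dvd d"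
  shows "moebius (p * d) = - moebius d"
proof -
  have "d \<noteq> 0" "p \<noteq> 0" using assms by (auto intro!: Nat.gr0I)
  have cop: "coprime p d" using assms by (simp add: prime_imp_coprime)
  have "squarefree (p * d) \<longleftrightarrow> squarefree d"
    using squarefree_mult_coprime[OF cop squarefree_prime[OF assms(1)]] squarefree_multD by blast
  moreover have "prime_factors (p * d) = insert p (prime_factors d)"
    using \<open>d \<noteq> 0\<close> \<open>p \<noteq> 0\<close> assms(1) by (simp add: prime_factors_product prime_prime_factors)
  moreover have "p \<notin> prime_factors d" using assms by auto
  ultimately show ?thesis by (simp add: moebius_def)
qed

lemma abs_moebius_le_1: "\<bar>moebius n\<bar> \<le> 1"
  by (simp add: moebius_def power_abs)

text \<open>For a prime \<open>p\<close> dividing \<open>N\<close>, the divisors prime to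
  \<open>p\<close> cancel against their multiples by \<open>p\<close>. Every remaining divisor
  contains \<open>p\<close> at least twice, hence is not squarefree and contributes nothing.\<close>

lemma sum_moebius_divisors:
  assumes "N \<ge> 1"
  shows "(\<Sum>d | d dvd N. moebius d) = (if N = 1 then 1 else 0)"
proof (cases "N = 1")
  case True
  then show ?thesis by (simp add: moebius_def)
next
  case False
  then obtain p where p: "prime p" "p dvd N" using prime_factor_nat by blast
  define D where "D = {d. d dvd N \<and> \<not> p dvd d}"
  have fin: "finite {d. d dvd N}" using assms by simp
  have finD: "finite D" unfolding D_def by (rule finite_subset[OF _ fin]) auto
  have inj: "inj_on ((*) p) D" using p by (auto intro!: inj_onI)
  have disj: "D \<inter> (*) p ` D = {}" by (auto simp: D_def)
  have sub: "D \<union> (*) p ` D \<subseteq> {d. d dvd N}"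
    using p by (auto simp: D_def intro: divides_mult prime_imp_coprime)
  have zero: "moebius d = 0" if "d \<in> {d. d dvd N} - (D \<union> (*) p ` D)" for d
  proof -
    from that obtain e where e: "d = p * e" by (auto simp: D_def)
    with that have "p dvd e" by (auto simp: D_def dest: dvd_mult_right)
    then have "p ^ 2 dvd d" by (auto simp: e power2_eq_square)
    with p(1) have "\<not> squarefree d" using not_squarefreeI not_prime_unit by blast
    then show ?thesis by (simp add: moebius_def)
  qed
  have "(\<Sum>d | d dvd N. moebius d) = (\<Sum>d\<in>D \<union> (*) p ` D. moebius d)"
    using fin sub zero by (intro sum.mono_neutral_right) auto
  also have "\<dots> = (\<Sum>d\<in>D. moebius d) + (\<Sum>d\<in>D. moebius (p * d))"
    using finD disj inj by (simp add: sum.union_disjoint sum.reindex)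
  also have "(\<Sum>d\<in>D. moebius (p * d)) = (\<Sum>d\<in>D. - moebius d)"
    using p(1) by (intro sum.cong) (auto simp: D_def moebius_prime_mult)
  finally show ?thesis using False by (simp add: sum_negf)
qed

section \<open>Series with value 1 / zeta(2)\<close>

text \<open>The ordered series of the definition has nonnegative terms, so it also converges
  unconditionally; this is what permits regrouping later.\<close>

lemma has_sum_riemann_zeta_2: "((\<lambda>k. 1 / (real k)\<^sup>2) has_sum riemann_zeta 2) {1..}"
proof -
  have "summable (\<lambda>k. 1 / (real (Suc k))\<^sup>2)"
    using inverse_power_summable[of 2, where 'a = real]
    by (subst summable_Suc_iff) (simp add: inverse_eq_divide)
  then have "((\<lambda>k. 1 / (real (Suc k))\<^sup>2) has_sum (\<Sum>k. 1 / (real (Suc k))\<^sup>2)) UNIV"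
    by (intro norm_summable_imp_has_sum summable_sums) simp_all
  also have "(\<Sum>k. 1 / (real (Suc k))\<^sup>2) = riemann_zeta 2"
    by (simp add: riemann_zeta_def)
  also have "((\<lambda>k. 1 / (real (Suc k))\<^sup>2) has_sum riemann_zeta 2) UNIV \<longleftrightarrow> ?thesis"
    by (rule has_sum_reindex_bij_witness[of _ "\<lambda>k. k - 1" Suc]) auto
  finally show ?thesis .
qed

lemma summable_on_Times_nonneg:
  fixes f g :: "_ \<Rightarrow> real"
  assumes "f summable_on A" "g summable_on B" "\<And>x. x \<in> A \<Longrightarrow> f x \<ge> 0" "\<And>y. y \<in> B \<Longrightarrow> g y \<ge> 0"
  shows "(\<lambda>(x, y). f x * g y) summable_on A \<times> B"
proof (rule summable_on_SigmaI)
  show "((\<lambda>y. case (x, y) of (x, y) \<Rightarrow> f x * g y) has_sum f x * infsum g B) B" for x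
    using assms(2) by (auto intro!: has_sum_cmult_right)
  show "(\<lambda>x. f x * infsum g B) summable_on A" using assms(1) by (rule summable_on_cmult_left)
qed (use assms in auto)

text \<open>Absolute summability of both factors makes the product family summable, after which the
  sum may be computed row by row.\<close>

lemma has_sum_Times:
  fixes f g :: "_ \<Rightarrow> real"
  assumes "(f has_sum S) A" "(g has_sum T) B" "(\<lambda>x. \<bar>f x\<bar>) summable_on A" "(\<lambda>y. \<bar>g y\<bar>) summable_on B"
  shows "((\<lambda>(x, y). f x * g y) has_sum S * T) (A \<times> B)"
proof (rule has_sum_SigmaI)
  have "(\<lambda>(x, y). \<bar>f x\<bar> * \<bar>g y\<bar>) summable_on A \<times> B"
    using assms(3,4) by (rule summable_on_Times_nonneg) auto
  then show "(\<lambda>(x, y). f x * g y) summable_on A \<times> B"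
    using abs_summable_summable[of "\<lambda>(x, y). f x * g y" "A \<times> B"]
    by (simp add: case_prod_unfold abs_mult)
  show "((\<lambda>y. case (x, y) of (x, y) \<Rightarrow> f x * g y) has_sum f x * T) B" for x
    using assms(2) by (auto intro!: has_sum_cmult_right)
  show "((\<lambda>x. f x * T) has_sum S * T) A" using assms(1) by (rule has_sum_cmult_left)
qed

text \<open>
  Multiply the series by \<open>\<zeta>(2)\<close> and group the terms by \<open>N = g i * k\<close>: only \<open>N = 1\<close> survives.
\<close>
lemma has_sum_inverse_zeta_2:
  fixes c :: "'i \<Rightarrow> real" and g :: "'i \<Rightarrow> nat"
  assumes g: "\<And>i. i \<in> A \<Longrightarrow> g i \<ge> 1"
    and c: "\<And>i. i \<in> A \<Longrightarrow> \<bar>c i\<bar> \<le> 1"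
    and summable: "(\<lambda>i. 1 / (real (g i))\<^sup>2) summable_on A"
    and fin: "\<And>N. N \<ge> 1 \<Longrightarrow> finite {i \<in> A. g i dvd N}"
    and sum: "\<And>N. N \<ge> 1 \<Longrightarrow> (\<Sum>i | i \<in> A \<and> g i dvd N. c i) = (if N = 1 then 1 else 0)"
  shows "(\<lambda>i. \<bar>c i / (real (g i))\<^sup>2\<bar>) summable_on A"
    and "((\<lambda>i. c i / (real (g i))\<^sup>2) has_sum 1 / riemann_zeta 2) A"
proof -
  let ?f = "\<lambda>i. c i / (real (g i))\<^sup>2" and ?D = "\<lambda>N. {i \<in> A. g i dvd N}"
  show abs: "(\<lambda>i. \<bar>?f i\<bar>) summable_on A"
    by (rule summable_on_comparison_test[OF summable])
      (use c in \<open>auto simp: abs_mult intro!: divide_right_mono\<close>)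
  then have f: "(?f has_sum infsum ?f A) A"
    using abs_summable_summable[of ?f A] by simp
  have prod: "((\<lambda>(i, k). ?f i * (1 / (real k)\<^sup>2)) has_sum infsum ?f A * riemann_zeta 2) (A \<times> {1..})"
    using has_sum_Times[OF f has_sum_riemann_zeta_2 abs] has_sum_riemann_zeta_2
    by (auto simp: summable_on_def)
  have "((\<lambda>(i, k). ?f i * (1 / (real k)\<^sup>2)) has_sum infsum ?f A * riemann_zeta 2) (A \<times> {1..}) \<longleftrightarrow>
    ((\<lambda>(N, i). c i / (real N)\<^sup>2) has_sum infsum ?f A * riemann_zeta 2) (Sigma {1..} ?D)"
  proof (rule has_sum_reindex_bij_witness[of _ "\<lambda>(N, i). (i, N div g i)" "\<lambda>(i, k). (g i * k, i)"])
    fix p assume "p \<in> A \<times> {1::nat..}"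
    then obtain i k where p: "p = (i, k)" "i \<in> A" "k \<ge> 1" by auto
    with g[of i] show "(\<lambda>(N, i). (i, N div g i)) ((\<lambda>(i, k). (g i * k, i)) p) = p"
      "(\<lambda>(i, k). (g i * k, i)) p \<in> Sigma {1..} ?D"
      "(case (\<lambda>(i, k). (g i * k, i)) p of (N, i) \<Rightarrow> c i / (real N)\<^sup>2) =
        (case p of (i, k) \<Rightarrow> ?f i * (1 / (real k)\<^sup>2))"
      by (auto simp: power_mult_distrib Suc_le_eq)
  next
    fix q assume "q \<in> Sigma {1..} ?D"
    then obtain N i where q: "q = (N, i)" "i \<in> A" "N \<ge> 1" "g i dvd N" by auto
    then have "N div g i \<ge> 1" using g[of i] by (simp add: Suc_le_eq div_greater_zero_iff dvd_imp_le)
    with q show "(\<lambda>(i, k). (g i * k, i)) ((\<lambda>(N, i). (i, N div g i)) q) = q"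
      "(\<lambda>(N, i). (i, N div g i)) q \<in> A \<times> {1..}"
      by auto
  qed simp
  with prod have "((\<lambda>(N, i). c i / (real N)\<^sup>2) has_sum infsum ?f A * riemann_zeta 2) (Sigma {1..} ?D)"
    by simp
  then have "((\<lambda>N. \<Sum>i\<in>?D N. c i / (real N)\<^sup>2) has_sum infsum ?f A * riemann_zeta 2) {1..}"
    by (rule has_sum_SigmaD) (use fin in auto)
  moreover have "(\<Sum>i\<in>?D N. c i / (real N)\<^sup>2) = (if N = 1 then 1 else 0)" if "N \<in> {1..}" for N
    using sum[of N] that by (simp flip: sum_divide_distrib)
  ultimately have "((\<lambda>N. if N = 1 then 1 else 0) has_sum infsum ?f A * riemann_zeta 2) {1::nat..}"
    by (subst (asm) has_sum_cong)
  moreover have "((\<lambda>N. if N = 1 then 1 else 0) has_sum (1::real)) {1::nat..}"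
    by (rule has_sum_finite_neutralI[of "{1}"]) auto
  ultimately have "infsum ?f A * riemann_zeta 2 = 1" by (rule has_sum_unique)
  \<comment> \<open>A product equal to \<open>1\<close> also forces \<open>riemann_zeta 2\<close> to
    be nonzero, which justifies the division.\<close>
  then have "infsum ?f A = 1 / riemann_zeta 2" by (metis eq_divide_eq mult_zero_right zero_neq_one)
  with f show "(?f has_sum 1 / riemann_zeta 2) A" by simp
qed

text \<open>With \<open>d = gcd m n\<close>, the map from \<open>(m, n)\<close> to
  \<open>(d, m div d, n div d)\<close> is injective, and \<open>lcm m n\<close> is the product of
  the three components. The family is thus a subfamily of the triple product of the series for
  zeta(2).\<close>

lemma summable_on_inverse_lcm_square:
  "(\<lambda>(m, n). 1 / (real (lcm m n))\<^sup>2) summable_on {1..} \<times> {1..}"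
proof -
  let ?q = "\<lambda>k. 1 / (real k)\<^sup>2"
  let ?t = "\<lambda>(m :: nat, n :: nat). (gcd m n, m div gcd m n, n div gcd m n)"
  have q: "?q summable_on {1..}" using has_sum_riemann_zeta_2 by (auto simp: summable_on_def)
  have "(\<lambda>(d, m, n). ?q d * (?q m * ?q n)) summable_on {1..} \<times> {1..} \<times> {1..}"
    using summable_on_Times_nonneg[OF q summable_on_Times_nonneg[OF q q]]
    by (simp add: case_prod_unfold)
  moreover have "?t ` ({1..} \<times> {1..}) \<subseteq> {1..} \<times> {1..} \<times> {1..}"
    by (auto simp: Suc_le_eq div_greater_zero_iff intro: gcd_le1_nat gcd_le2_nat)
  ultimately have "(\<lambda>(d, m, n). ?q d * (?q m * ?q n)) summable_on ?t ` ({1..} \<times> {1..})"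
    by (rule summable_on_subset_banach)
  moreover have "inj_on ?t ({1..} \<times> {1..})"
    by (rule inj_on_inverseI[of _ "\<lambda>(d, m, n). (d * m, d * n)"]) auto
  ultimately have "((\<lambda>(d, m, n). ?q d * (?q m * ?q n)) \<circ> ?t) summable_on {1..} \<times> {1..}"
    by (simp add: summable_on_reindex)
  also have "?this \<longleftrightarrow> ?thesis"
  proof (rule summable_on_cong)
    fix p :: "nat \<times> nat"
    obtain m n where p: "p = (m, n)" by force
    have "lcm m n = gcd m n * (m div gcd m n) * (n div gcd m n)"
      by (simp add: lcm_nat_def div_mult_swap)
    then have "real (lcm m n) = real (gcd m n) * real (m div gcd m n) * real (n div gcd m n)"
      by (simp only: of_nat_mult)
    then show "((\<lambda>(d, m, n). ?q d * (?q m * ?q n)) \<circ> ?t) p = (case p of (m, n) \<Rightarrow> ?q (lcm m n))"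
      by (simp only: p o_def prod.case power_mult_distrib) simp
  qed
  finally show ?thesis .
qed

text \<open>The case where \<open>g\<close> is the identity. Absolute summability is recorded as
  well because \<open>has_sum_Times\<close> asks for it.\<close>

lemma has_sum_moebius:
  shows "(\<lambda>n. \<bar>real_of_int (moebius n) / (real n)\<^sup>2\<bar>) summable_on {1..}"
    and "((\<lambda>n. real_of_int (moebius n) / (real n)\<^sup>2) has_sum 1 / riemann_zeta 2) {1..}"
proof -
  \<comment> \<open>Since \<open>0\<close> divides no positive \<open>N\<close>, the restriction to
    positive indices loses no divisor.\<close>
  have D: "{n \<in> {1..}. n dvd N} = {n. n dvd N}" if "N \<ge> 1" for N :: nat
    using that by (auto simp: Suc_le_eq dest: dvd_pos_nat)
  have s: "(\<Sum>n | n \<in> {1..} \<and> n dvd N. real_of_int (moebius n)) = (if N = 1 then 1 else 0)"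
    if "N \<ge> 1" for N
    unfolding D[OF that] using sum_moebius_divisors[OF that] by (simp flip: of_int_sum)
  have c: "\<bar>real_of_int (moebius n)\<bar> \<le> 1" for n
    using abs_moebius_le_1[of n] by linarith
  have sm: "(\<lambda>n. 1 / (real n)\<^sup>2) summable_on {1..}"
    using has_sum_riemann_zeta_2 by (auto simp: summable_on_def)
  show "(\<lambda>n. \<bar>real_of_int (moebius n) / (real n)\<^sup>2\<bar>) summable_on {1..}"
    by (rule has_sum_inverse_zeta_2(1)) (use c sm s in \<open>auto simp: D\<close>)
  show "((\<lambda>n. real_of_int (moebius n) / (real n)\<^sup>2) has_sum 1 / riemann_zeta 2) {1..}"
    by (rule has_sum_inverse_zeta_2(2)) (use c sm s in \<open>auto simp: D\<close>)
qed

text \<open>As \<open>lcm m n\<close> divides \<open>N\<close> exactly when both \<open>m\<close>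
  and \<open>n\<close> do, the sum over such pairs is the square of the divisor sum of
  \<open>moebius\<close>, again \<open>1\<close> at \<open>N = 1\<close> and \<open>0\<close>
  elsewhere.\<close>

lemma has_sum_moebius_lcm:
  "((\<lambda>(m, n). real_of_int (moebius m * moebius n) / (real (lcm m n))\<^sup>2) has_sum 1 / riemann_zeta 2)
    ({1..} \<times> {1..})"
proof -
  let ?g = "\<lambda>(m, n). lcm m n :: nat" and ?c = "\<lambda>(m, n). real_of_int (moebius m * moebius n)"
  have D: "{i \<in> {1..} \<times> {1..}. ?g i dvd N} = {n. n dvd N} \<times> {n. n dvd N}" if "N \<ge> 1" for N :: nat
    using that by (auto simp: Suc_le_eq dest: dvd_pos_nat)
  have s: "(\<Sum>i | i \<in> {1..} \<times> {1..} \<and> ?g i dvd N. ?c i) = (if N = 1 then 1 else 0)"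
    if "N \<ge> 1" for N
  proof -
    have "(\<Sum>i | i \<in> {1..} \<times> {1..} \<and> ?g i dvd N. ?c i)
      = of_int ((\<Sum>n | n dvd N. moebius n) * (\<Sum>n | n dvd N. moebius n))"
      unfolding D[OF that] sum_product by (simp add: sum.cartesian_product case_prod_unfold)
    then show ?thesis by (simp add: sum_moebius_divisors[OF that])
  qed
  have c: "\<bar>?c i\<bar> \<le> 1" for i
    using mult_mono[OF abs_moebius_le_1[of "fst i"] abs_moebius_le_1[of "snd i"]]
    by (simp add: case_prod_unfold flip: abs_mult of_int_mult of_int_abs)
  have sm: "(\<lambda>i. 1 / (real (?g i))\<^sup>2) summable_on {1..} \<times> {1..}"
    using summable_on_inverse_lcm_square by (simp add: case_prod_unfold)
  have "((\<lambda>i. ?c i / (real (?g i))\<^sup>2) has_sum 1 / riemann_zeta 2) ({1..} \<times> {1..})"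
  proof (rule has_sum_inverse_zeta_2(2))
    show "?g i \<ge> 1" if "i \<in> {1..} \<times> {1..}" for i
      using that by (auto simp: Suc_le_eq lcm_pos_nat)
    show "finite {i \<in> {1..} \<times> {1..}. ?g i dvd N}" if "N \<ge> 1" for N
      unfolding D[OF that] using that by simp
  qed (use c sm s in auto)
  then show ?thesis by (simp add: case_prod_unfold)
qed

section \<open>Limits of averages\<close>

lemma sum_periodic_shift:
  fixes g :: "nat \<Rightarrow> 'a :: ab_group_add"
  assumes "\<And>x. g (x + L) = g x"
  shows "(\<Sum>b<L. g (a + b)) = (\<Sum>c<L. g c)"
proof (induction a)
  case (Suc a)
  have "(\<Sum>b<L. g (Suc a + b)) + g a = (\<Sum>b<Suc L. g (a + b))"
    by (simp add: sum.lessThan_Suc_shift del: sum.lessThan_Suc)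
  also have "\<dots> = (\<Sum>b<L. g (a + b)) + g a" by (simp add: assms)
  finally show ?case using Suc by simp
qed simp

text \<open>The deviation \<open>D X\<close> of the partial sum from \<open>X\<close> times the mean
  over one period is itself periodic, hence bounded, and so vanishes after division by
  \<open>X\<close>.\<close>

lemma average_periodic_tendsto:
  fixes f :: "nat \<Rightarrow> real"
  assumes L: "L \<ge> 1" and per: "\<And>x. f (x + L) = f x"
  shows "average f \<longlonglongrightarrow> (\<Sum>r<L. f r) / real L"
proof -
  let ?M = "(\<Sum>r<L. f r) / real L"
  define D where "D X = (\<Sum>x=1..X. f x) - real X * ?M" for X
  have D_add: "D (X + L) = D X" for X
  proof -
    have "(\<Sum>x=1..X + L. f x) = (\<Sum>x=1..X. f x) + (\<Sum>x=X+1..X+L. f x)"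
      by (rule sum.ub_add_nat) simp
    also have "(\<Sum>x=X+1..X+L. f x) = (\<Sum>b<L. f (Suc X + b))"
      by (rule sum.reindex_bij_witness[of _ "\<lambda>b. Suc X + b" "\<lambda>x. x - Suc X"]) auto
    also have "\<dots> = sum f {..<L}" by (rule sum_periodic_shift[of f L, OF per])
    also have "\<dots> = real L * ?M" using L by simp
    finally show ?thesis unfolding D_def of_nat_add distrib_right by linarith
  qed
  have D_mod: "D X = D (X mod L)" for X
  proof -
    have "D (r + L * k) = D r" for r k
      by (induction k) (simp_all add: D_add add.assoc[symmetric] add.commute[of L])
    from this[of "X mod L" "X div L"] show ?thesis by simp
  qed
  have bound: "\<bar>D X\<bar> \<le> (\<Sum>r<L. \<bar>D r\<bar>)" for X
    using member_le_sum[of "X mod L" "{..<L}" "\<lambda>r. \<bar>D r\<bar>"] L by (simp add: D_mod[of X])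
  have "(\<lambda>X. D X / real X) \<longlonglongrightarrow> 0"
  proof (rule Lim_null_comparison)
    show "\<forall>\<^sub>F X in sequentially. norm (D X / real X) \<le> (\<Sum>r<L. \<bar>D r\<bar>) / real X"
      using bound by (auto intro!: always_eventually divide_right_mono)
    show "(\<lambda>X. (\<Sum>r<L. \<bar>D r\<bar>) / real X) \<longlonglongrightarrow> 0" by (rule lim_const_over_n)
  qed
  then have "(\<lambda>X. D X / real X + ?M) \<longlonglongrightarrow> 0 + ?M" by (intro tendsto_add tendsto_const)
  \<comment> \<open>The equality is only eventual: at \<open>X = 0\<close> the left side is
    \<open>?M\<close>, while the average is \<open>0\<close>.\<close>
  moreover have "\<forall>\<^sub>F X in sequentially. D X / real X + ?M = average f X"
    using eventually_gt_at_top[of 0]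
    by eventually_elim (simp add: D_def average_def diff_divide_distrib)
  ultimately show ?thesis by (simp add: tendsto_cong)
qed

lemma average_of_bool: "average (\<lambda>x. of_bool (P x)) X = real (card {x \<in> {1..X}. P x}) / real X"
  by (simp add: average_def of_bool_def flip: sum.inter_filter)

lemma average_cmult: "average (\<lambda>x. c * f x) X = c * average f X"
  by (simp add: average_def sum_distrib_left mult.left_commute)

lemma average_sum: "average (\<lambda>x. \<Sum>i\<in>I. f i x) X = (\<Sum>i\<in>I. average (f i) X)"
  unfolding average_def by (subst sum.swap) (simp add: sum_distrib_left)

text \<open>Joint frequency is conditional frequency times the frequency of the condition; this
  holds at every \<open>X\<close>, so the limits multiply.\<close>

lemma cond_prob_imp_average_tendsto:
  assumes "cond_prob P Q p" and "average (\<lambda>x. of_bool (Q x)) \<longlonglongrightarrow> q"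
  shows "average (\<lambda>x. of_bool (Q x \<and> P x)) \<longlonglongrightarrow> p * q"
proof -
  have "average (\<lambda>x. of_bool (Q x \<and> P x)) X =
      real (card {x \<in> {1..X}. Q x \<and> P x}) / real (card {x \<in> {1..X}. Q x}) *
      average (\<lambda>x. of_bool (Q x)) X" for X
  proof (cases "{x \<in> {1..X}. Q x} = {}")
    \<comment> \<open>The denominator is \<open>0\<close> here, and both sides are
      \<open>0\<close>.\<close>
    case True
    then have "{x \<in> {1..X}. Q x \<and> P x} = {}" by blast
    then show ?thesis by (simp only: average_of_bool True) simp
  next
    case False
    then have "card {x \<in> {1..X}. Q x} \<noteq> 0" by (subst card_0_eq) simp_all
    then show ?thesis by (simp add: average_of_bool)
  qed
  with tendsto_mult[OF assms(1)[unfolded cond_prob_def] assms(2)] show ?thesis by presburger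
qed

text \<open>Each residue of \<open>x\<close> has frequency \<open>1 / L\<close>, so uniformity of
  \<open>s x\<close> given that residue makes every pair of residues occur with frequency
  \<open>1 / L\<close> squared. The average is a finite linear combination of the averages of the
  indicators of these pairs.\<close>

lemma average_tendsto_uniform_residues:
  fixes F :: "nat \<Rightarrow> nat \<Rightarrow> real" and s :: "nat \<Rightarrow> nat"
  assumes L: "L \<ge> 1"
    and unif: "\<And>a b. a < L \<Longrightarrow> b < L \<Longrightarrow>
      cond_prob (\<lambda>x. [s x = b] (mod L)) (\<lambda>x. [x = a] (mod L)) (1 / real L)"
  shows "average (\<lambda>x. F (x mod L) (s x mod L)) \<longlonglongrightarrow> (\<Sum>a<L. \<Sum>b<L. F a b) / (real L)\<^sup>2"
proof -
  have joint: "average (\<lambda>x. of_bool (x mod L = a \<and> s x mod L = b)) \<longlonglongrightarrow> 1 / (real L)\<^sup>2"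
    if "a < L" "b < L" for a b
  proof -
    have "average (\<lambda>x. of_bool ([x = a] (mod L))) \<longlonglongrightarrow> (\<Sum>r<L. of_bool ([r = a] (mod L))) / real L"
      by (rule average_periodic_tendsto[OF L]) (simp add: cong_def)
    also have "(\<Sum>r<L. of_bool ([r = a] (mod L))) = (\<Sum>r<L. if r = a then 1 else 0 :: real)"
      using that by (intro sum.cong) (auto simp: cong_def)
    also have "\<dots> = 1" using that by simp
    finally have "average (\<lambda>x. of_bool ([x = a] (mod L) \<and> [s x = b] (mod L)))
        \<longlonglongrightarrow> 1 / real L * (1 / real L)"
      using cond_prob_imp_average_tendsto unif[OF that] by blast
    then show ?thesis using that by (simp add: cong_def power2_eq_square)
  qed
  have "F (x mod L) (s x mod L) =
      (\<Sum>a<L. \<Sum>b<L. F a b * of_bool (x mod L = a \<and> s x mod L = b))" for x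
  proof -
    have "(\<Sum>a<L. \<Sum>b<L. F a b * of_bool (x mod L = a \<and> s x mod L = b)) =
        (\<Sum>a<L. if x mod L = a then \<Sum>b<L. if s x mod L = b then F a b else 0 else 0)"
      by (intro sum.cong) (auto intro!: sum.cong)
    then show ?thesis using L by simp
  qed
  then have "average (\<lambda>x. F (x mod L) (s x mod L)) =
      average (\<lambda>x. \<Sum>a<L. \<Sum>b<L. F a b * of_bool (x mod L = a \<and> s x mod L = b))"
    by (rule arg_cong[of _ _ average, OF ext])
  also have "\<dots> =
      (\<lambda>X. \<Sum>a<L. \<Sum>b<L. F a b * average (\<lambda>x. of_bool (x mod L = a \<and> s x mod L = b)) X)"
    by (rule ext) (simp only: average_sum average_cmult)
  also have "\<dots> \<longlonglongrightarrow> (\<Sum>a<L. \<Sum>b<L. F a b * (1 / (real L)\<^sup>2))"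
    by (intro tendsto_sum tendsto_mult tendsto_const joint) auto
  also have "(\<Sum>a<L. \<Sum>b<L. F a b * (1 / (real L)\<^sup>2)) = (\<Sum>a<L. \<Sum>b<L. F a b) / (real L)\<^sup>2"
    by (simp add: sum_divide_distrib)
  finally show ?thesis .
qed

section \<open>Covariance of residues\<close>

text \<open>By periodicity \<open>a + b\<close> may be replaced by an index \<open>c\<close>
  independent of \<open>a\<close>. Expanding the product then gives two equal diagonal and two equal
  mixed sums: twice the covariance, scaled by the square of \<open>L\<close>.\<close>

lemma sum_increment_products:
  fixes u v :: "nat \<Rightarrow> real"
  assumes u: "\<And>x. u (x + L) = u x" and v: "\<And>x. v (x + L) = v x"
  shows "(\<Sum>a<L. \<Sum>b<L. (u a - u (a + b)) * (v a - v (a + b))) =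
    2 * (real L * (\<Sum>c<L. u c * v c) - (\<Sum>c<L. u c) * (\<Sum>c<L. v c))"
proof -
  have "(\<Sum>b<L. (u a - u (a + b)) * (v a - v (a + b))) = (\<Sum>c<L. (u a - u c) * (v a - v c))" for a
    by (rule sum_periodic_shift[of "\<lambda>c. (u a - u c) * (v a - v c)"]) (simp add: u v)
  then have "(\<Sum>a<L. \<Sum>b<L. (u a - u (a + b)) * (v a - v (a + b))) =
      (\<Sum>a<L. \<Sum>c<L. u a * v a - u a * v c - u c * v a + u c * v c)"
    by (simp add: algebra_simps)
  also have "\<dots> = 2 * (real L * (\<Sum>c<L. u c * v c) - (\<Sum>c<L. u c) * (\<Sum>c<L. v c))"
    by (simp add: sum.distrib sum_subtractf sum_product sum_distrib_left
        sum.swap[of "\<lambda>a c. u c * v a"] algebra_simps)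
  finally show ?thesis .
qed

text \<open>As \<open>k\<close> runs through one period, the pair of its residues runs exactly once
  through all pairs.\<close>

lemma sum_chinese_remainder:
  fixes f g :: "nat \<Rightarrow> 'a :: comm_semiring_0"
  assumes "coprime p q" "p \<ge> 1" "q \<ge> 1"
  shows "(\<Sum>k<p * q. f (k mod p) * g (k mod q)) = (\<Sum>i<p. f i) * (\<Sum>j<q. g j)"
proof -
  have inj: "inj_on (\<lambda>k. (k mod p, k mod q)) {..<p * q}"
  proof (rule inj_onI)
    fix k l assume "k \<in> {..<p * q}" "l \<in> {..<p * q}" "(k mod p, k mod q) = (l mod p, l mod q)"
    then show "k = l"
      using binary_chinese_remainder_unique_nat[OF assms(1), of l l] assms
      by (auto simp: cong_def)
  qed
  \<comment> \<open>Surjectivity comes from counting: the injective image has \<open>p * q\<close>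
    elements, as many as the target.\<close>
  moreover have "(\<lambda>k. (k mod p, k mod q)) ` {..<p * q} = {..<p} \<times> {..<q}"
    using assms inj by (intro card_subset_eq) (auto simp: card_image)
  ultimately have "bij_betw (\<lambda>k. (k mod p, k mod q)) {..<p * q} ({..<p} \<times> {..<q})"
    by (simp add: bij_betw_def)
  from sum.reindex_bij_betw[OF this, of "\<lambda>(i, j). f i * g j"] show ?thesis
    by (simp add: sum_product sum.cartesian_product)
qed

lemma sum_lessThan_mult:
  fixes f :: "nat \<Rightarrow> 'a :: comm_monoid_add"
  shows "(\<Sum>c<d * K. f c) = (\<Sum>r<d. \<Sum>k<K. f (r + d * k))"
proof -
  have "(\<Sum>c<d * K. f c) = (\<Sum>k<K. sum f {k * d..<k * d + d})"
    by (simp add: sum.nat_group mult.commute)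
  also have "\<dots> = (\<Sum>k<K. \<Sum>r<d. f (r + d * k))"
  proof (rule sum.cong)
    show "sum f {k * d..<k * d + d} = (\<Sum>r<d. f (r + d * k))" for k
      by (rule sum.reindex_bij_witness[of _ "\<lambda>r. r + d * k" "\<lambda>c. c - d * k"])
        (auto simp: mult.commute)
  qed simp
  finally show ?thesis by (simp add: sum.swap[of _ "{..<d}"])
qed

lemma sum_lessThan_of_nat: "(\<Sum>r<d. real r) = real d * (real d - 1) / 2"
  by (induction d) (auto simp: field_simps)

lemma sum_lessThan_of_nat_square: "(\<Sum>r<d. (real r)\<^sup>2) = real d * (real d - 1) * (2 * real d - 1) / 6"
  by (induction d) (auto simp: field_simps power2_eq_square)

text \<open>
  Write \<open>c < d * p * q\<close> as \<open>r + d * k\<close> with \<open>r < d\<close>. For fixed \<open>r\<close> the two residues of \<open>c\<close> vary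
  independently by the Chinese remainder theorem, so the covariance is that of their conditional
  means, which differ from \<open>r\<close> by constants.
\<close>
lemma covariance_residues:
  fixes d p q :: nat
  assumes "coprime p q" "d \<ge> 1" "p \<ge> 1" "q \<ge> 1"
  defines "L \<equiv> d * (p * q)"
  shows "real L * (\<Sum>c<L. real (c mod (d * p)) * real (c mod (d * q))) -
      (\<Sum>c<L. real (c mod (d * p))) * (\<Sum>c<L. real (c mod (d * q))) =
    (real L)\<^sup>2 * ((real d)\<^sup>2 - 1) / 12"
proof -
  \<comment> \<open>These are the means of \<open>d * (k mod p)\<close> and
    \<open>d * (k mod q)\<close> over full periods.\<close>
  define \<alpha> \<beta> where "\<alpha> = real d * (real p - 1) / 2" and "\<beta> = real d * (real q - 1) / 2"
  have residue: "real ((r + d * k) mod (d * n)) = real r + real d * real (k mod n)" if "r < d" for r k n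
    using that by (simp add: mod_mult2_eq)
  have progression: "(\<Sum>i<n. real r + real d * real i) = real n * (real r + real d * (real n - 1) / 2)"
    for r n
    by (simp only: sum.distrib sum_distrib_left[symmetric] sum_lessThan_of_nat) (simp add: field_simps)
  \<comment> \<open>The one-residue sums are the product rule with the other factor constantly
    \<open>1\<close>.\<close>
  have p: "(\<Sum>k<p * q. real r + real d * real (k mod p)) = real p * real q * (real r + \<alpha>)" for r
    using sum_chinese_remainder[OF assms(1,3,4), of "\<lambda>i. real r + real d * real i" "\<lambda>_. 1"]
    unfolding progression by (simp add: \<alpha>_def mult_ac)
  have q: "(\<Sum>k<p * q. real r + real d * real (k mod q)) = real p * real q * (real r + \<beta>)" for r
    using sum_chinese_remainder[OF assms(1,3,4), of "\<lambda>_. 1" "\<lambda>i. real r + real d * real i"]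
    unfolding progression by (simp add: \<beta>_def mult_ac)
  have pq: "(\<Sum>k<p * q. (real r + real d * real (k mod p)) * (real r + real d * real (k mod q))) =
      real p * real q * ((real r + \<alpha>) * (real r + \<beta>))" for r
    using sum_chinese_remainder[OF assms(1,3,4), of "\<lambda>i. real r + real d * real i" "\<lambda>i. real r + real d * real i"]
    unfolding progression by (simp add: \<alpha>_def \<beta>_def mult_ac)
  have sums: "(\<Sum>c<L. real (c mod (d * p))) = real p * real q * (\<Sum>r<d. real r + \<alpha>)"
    "(\<Sum>c<L. real (c mod (d * q))) = real p * real q * (\<Sum>r<d. real r + \<beta>)"
    "(\<Sum>c<L. real (c mod (d * p)) * real (c mod (d * q))) =
      real p * real q * (\<Sum>r<d. (real r + \<alpha>) * (real r + \<beta>))"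
    unfolding L_def sum_lessThan_mult[of _ d "p * q"]
    by (simp_all add: residue p q pq flip: sum_distrib_left)
  have linear: "(\<Sum>r<d. real r + \<gamma>) = real d * (real d - 1) / 2 + real d * \<gamma>" for \<gamma>
    by (simp add: sum.distrib sum_lessThan_of_nat)
  have "(\<Sum>r<d. (real r + \<alpha>) * (real r + \<beta>)) =
      (\<Sum>r<d. (real r)\<^sup>2 + (\<alpha> + \<beta>) * real r + \<alpha> * \<beta>)"
    by (simp add: algebra_simps power2_eq_square)
  then have quadratic: "(\<Sum>r<d. (real r + \<alpha>) * (real r + \<beta>)) =
      real d * (real d - 1) * (2 * real d - 1) / 6 + (\<alpha> + \<beta>) * (real d * (real d - 1) / 2) + \<alpha> * (real d * \<beta>)"
    by (simp only: sum.distrib sum_lessThan_of_nat sum_lessThan_of_nat_square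
        sum_distrib_left[symmetric] sum_constant card_lessThan)
  \<comment> \<open>The shifts \<alpha> and \<beta> cancel. What is left is the variance of a
    uniform \<open>r < d\<close>, namely \<open>(d^2 - 1) / 12\<close>, times the square of
    \<open>L\<close>.\<close>
  show ?thesis
    unfolding sums linear quadratic by (simp add: L_def field_simps power2_eq_square)
qed

section \<open>The limit for a fixed pair\<close>

lemma frac_of_nat_divide: "frac (real x / real n) = real (x mod n) / real n"
proof (cases "n = 0")
  case False
  have "real x / real n = real (x div n) + real (x mod n) / real n"
    using False by (simp add: field_simps flip: of_nat_mult of_nat_add)
  then show ?thesis by (simp add: frac_def floor_divide_of_nat_eq)
qed simp

text \<open>The summand depends only on the residues of \<open>x\<close> and of the floor modulo a
  common multiple of \<open>m\<close> and \<open>n\<close>, so its limit is a finite mean over pairs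
  of residues. That mean is a covariance, and \<open>gcd m n * lcm m n = m * n\<close> brings it
  into the stated form.\<close>

lemma average_summand_tendsto:
  assumes unif: "\<And>L a b. L \<ge> 1 \<Longrightarrow> a < L \<Longrightarrow> b < L \<Longrightarrow>
      cond_prob (\<lambda>x. [\<lfloor>real x powr \<delta>\<rfloor> = int b] (mod int L)) (\<lambda>x. [x = a] (mod L)) (1 / real L)"
    and mn: "m \<ge> 1" "n \<ge> 1"
  shows "average (summand \<delta> m n) \<longlonglongrightarrow>
    1 / 6 * (real_of_int (moebius m * moebius n) / (real (lcm m n))\<^sup>2 -
      real_of_int (moebius m) / (real m)\<^sup>2 * (real_of_int (moebius n) / (real n)\<^sup>2))"
proof -
  define d where "d = gcd m n"
  \<comment> \<open>The letter \<open>p\<close> goes with \<open>n\<close>, since the factor with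
    \<open>n\<close> comes first in \<open>F\<close>.\<close>
  obtain q p where qp: "m = d * q" "n = d * p" "coprime p q"
    using mn gcd_coprime_exists[of m n] unfolding d_def by (metis coprime_commute gcd_eq_0_iff mult.commute not_one_le_zero)
  with mn have pos: "d \<ge> 1" "q \<ge> 1" "p \<ge> 1" by (auto simp: Suc_le_eq)
  \<comment> \<open>This is \<open>lcm m n\<close>, a common period of the residues modulo
    \<open>m\<close> and \<open>n\<close>.\<close>
  define L where "L = d * (p * q)"
  have L: "L \<ge> 1" using pos by (simp add: L_def Suc_le_eq)
  have dvd: "m dvd L" "n dvd L" by (auto simp: L_def qp)
  \<comment> \<open>The power is nonnegative, so \<open>nat\<close> changes no value, and residues
    can be handled in the natural numbers.\<close>
  define s where "s x = nat \<lfloor>real x powr \<delta>\<rfloor>" for x :: nat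
  have s: "\<lfloor>real x powr \<delta>\<rfloor> = int (s x)" for x by (simp add: s_def)
  define F where "F a b = (real (a mod n) - real ((a + b) mod n)) * (real (a mod m) - real ((a + b) mod m))"
    for a b
  let ?c = "real_of_int (moebius m * moebius n) / (real m * real n)\<^sup>2"
  have F: "F (x mod L) (s x mod L) = F x (s x)" for x
  proof -
    have "(x mod L + s x mod L) mod k = (x + s x) mod k" if "k dvd L" for k
      using that by (metis mod_add_eq mod_mod_cancel)
    then show ?thesis by (simp add: F_def dvd mod_mod_cancel)
  qed
  have "summand \<delta> m n x = ?c * F (x mod L) (s x mod L)" for x
  proof -
    have "real x + of_int \<lfloor>real x powr \<delta>\<rfloor> = real (x + s x)" by (simp add: s)
    then have "summand \<delta> m n x = of_int (moebius m) * of_int (moebius n) / (real m * real n) *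
      ((real (x mod n) / real n - real ((x + s x) mod n) / real n) *
       (real (x mod m) / real m - real ((x + s x) mod m) / real m))"
      unfolding summand_def Let_def by (simp only: frac_of_nat_divide) (simp add: algebra_simps)
    then have "summand \<delta> m n x = ?c * F x (s x)"
      by (simp add: F_def power2_eq_square mult_ac flip: diff_divide_distrib)
    then show ?thesis by (simp only: F)
  qed
  then have "average (summand \<delta> m n) = average (\<lambda>x. ?c * F (x mod L) (s x mod L))"
    by (rule arg_cong[of _ _ average, OF ext])
  also have "\<dots> = (\<lambda>X. ?c * average (\<lambda>x. F (x mod L) (s x mod L)) X)"
    by (rule ext) (rule average_cmult)
  \<comment> \<open>The uniformity assumption enters with the same modulus \<open>L\<close> for
    \<open>x\<close> and for the floor.\<close>
  also have "\<dots> \<longlonglongrightarrow> ?c * ((\<Sum>a<L. \<Sum>b<L. F a b) / (real L)\<^sup>2)"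
    using unif[OF L] L
    by (intro tendsto_mult tendsto_const average_tendsto_uniform_residues) (simp_all add: s cong_int_iff)
  also have "(\<Sum>a<L. \<Sum>b<L. F a b) / (real L)\<^sup>2 = ((real d)\<^sup>2 - 1) / 6"
  proof -
    have per: "(x + L) mod k = x mod k" if "k dvd L" for x k using that by (auto elim!: dvdE)
    have "(\<Sum>a<L. \<Sum>b<L. F a b) = 2 * (real L * (\<Sum>c<L. real (c mod n) * real (c mod m)) -
        (\<Sum>c<L. real (c mod n)) * (\<Sum>c<L. real (c mod m)))"
      unfolding F_def by (rule sum_increment_products) (simp_all only: per dvd)
    also have "\<dots> = 2 * ((real L)\<^sup>2 * ((real d)\<^sup>2 - 1) / 12)"
      using covariance_residues[OF qp(3) pos(1,3,2)] by (simp only: qp(1,2) L_def)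
    finally have "(\<Sum>a<L. \<Sum>b<L. F a b) = 2 * ((real L)\<^sup>2 * ((real d)\<^sup>2 - 1) / 12)" .
    with L show ?thesis by simp
  qed
  also have "?c * (((real d)\<^sup>2 - 1) / 6) =
    1 / 6 * (real_of_int (moebius m * moebius n) / (real (lcm m n))\<^sup>2 -
      real_of_int (moebius m) / (real m)\<^sup>2 * (real_of_int (moebius n) / (real n)\<^sup>2))"
  proof -
    have "real m * real n = real d * real (lcm m n)"
      unfolding d_def by (metis of_nat_mult prod_gcd_lcm_nat)
    then have "(real m * real n)\<^sup>2 = (real d)\<^sup>2 * (real (lcm m n))\<^sup>2" by (simp add: power_mult_distrib)
    moreover have "lcm m n > 0" using mn by (simp add: lcm_pos_nat)
    ultimately show ?thesis using pos mn by (simp add: field_simps)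
  qed
  finally show ?thesis .
qed

section \<open>Summation over all pairs\<close>

theorem theorem2p3:
  fixes \<delta> :: real
  assumes "0 < \<delta>" and "\<delta> < 1"
    and hyp: "\<And>(m::nat) (n::nat) (\<eta>::real) (r\<^sub>m::nat) (r\<^sub>n::nat).
      m \<ge> 1 \<Longrightarrow> n \<ge> 1 \<Longrightarrow> 0 < \<eta> \<Longrightarrow> \<eta> < 1 \<Longrightarrow> r\<^sub>m < m \<Longrightarrow> r\<^sub>n < n \<Longrightarrow>
      cond_prob (\<lambda>x. [\<lfloor>real x powr \<eta>\<rfloor> = int r\<^sub>m] (mod int m)) (\<lambda>x. [x = r\<^sub>n] (mod n)) (1 / real m)"
  shows "(\<forall>m\<ge>1. \<forall>n\<ge>1. convergent (average (summand \<delta> m n))) \<and>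
    ((\<lambda>(m, n). lim (average (summand \<delta> m n))) has_sum
       (1 / (6 * riemann_zeta 2) - 1 / (6 * (riemann_zeta 2)\<^sup>2))) ({1..} \<times> {1..})"
proof -
  let ?l = "\<lambda>m n. 1 / 6 * (real_of_int (moebius m * moebius n) / (real (lcm m n))\<^sup>2 -
      real_of_int (moebius m) / (real m)\<^sup>2 * (real_of_int (moebius n) / (real n)\<^sup>2))"
  have lim: "average (summand \<delta> m n) \<longlonglongrightarrow> ?l m n" if "m \<ge> 1" "n \<ge> 1" for m n
    using that hyp assms(1,2) by (intro average_summand_tendsto) auto
  \<comment> \<open>The lcm series contributes \<open>1 / riemann_zeta 2\<close>; the other factors
    into two Moebius series. The difference is written as a sum with a negated term to fit the rules
    for \<open>has_sum\<close>.\<close>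
  have "((\<lambda>p. 1 / 6 * ((\<lambda>(m, n). real_of_int (moebius m * moebius n) / (real (lcm m n))\<^sup>2) p +
      - (\<lambda>(m, n). real_of_int (moebius m) / (real m)\<^sup>2 * (real_of_int (moebius n) / (real n)\<^sup>2)) p))
    has_sum 1 / 6 * (1 / riemann_zeta 2 + - (1 / riemann_zeta 2 * (1 / riemann_zeta 2)))) ({1..} \<times> {1..})"
    by (intro has_sum_cmult_right has_sum_add has_sum_uminusI has_sum_moebius_lcm has_sum_Times has_sum_moebius)
  also have "1 / 6 * (1 / riemann_zeta 2 + - (1 / riemann_zeta 2 * (1 / riemann_zeta 2))) =
      1 / (6 * riemann_zeta 2) - 1 / (6 * (riemann_zeta 2)\<^sup>2)"
    by (simp add: algebra_simps power2_eq_square)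
  finally have "((\<lambda>(m, n). ?l m n) has_sum
      (1 / (6 * riemann_zeta 2) - 1 / (6 * (riemann_zeta 2)\<^sup>2))) ({1..} \<times> {1..})"
    by (simp only: case_prod_unfold diff_conv_add_uminus)
  also have "?this \<longleftrightarrow> ((\<lambda>(m, n). lim (average (summand \<delta> m n))) has_sum
      (1 / (6 * riemann_zeta 2) - 1 / (6 * (riemann_zeta 2)\<^sup>2))) ({1..} \<times> {1..})"
    \<comment> \<open>Only positive pairs matter, and there uniqueness of limits identifies
      \<open>lim\<close> with the computed value.\<close>
    by (rule has_sum_cong) (auto simp: limI[OF lim])
  finally show ?thesis using lim by (auto simp: convergent_def)
qed

end
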